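(* Let $r\ge 2$ and $a,b,c,d$ be integers satisfying $a\ge1$, $0\le d\le c\le b\le r$, $b+c-d\le r$, and $a+b\le r$. Put $L\coloneqq[0,d-1]\cup[b-c+d+1,b]$. Then $$\pi\bigl(T^r_{a,b,c,d}\bigr)\le \frac{\Psi(r,b,L)}{\binom{r}{b}}.$$ In particular, if $i\ge1$ and $r\ge 2i$ are integers, then $\pi\bigl(T^r_{i,r-i,r-i,r-2i}\bigr)\le\frac{i}{r}$.
   Context: Integer intervals: $[q]=\{1,\dots,q\}$ and $[p,q]=\{p,p+1,\dots,q\}$, with $[p,q]=\emptyset$ if $p>q$. For $r\ge2$, an $r$-graph is a family of $r$-subsets (edges) of a vertex set; $|H|$ is the number of edges of $H$. For a family $\mathcal F$ of $r$-graphs, $H$ is $\mathcal F$-free if it contains no member of $\mathcal F$ as a (not necessarily induced) subgraph; $\mathrm{ex}(n,\mathcal F)=\max\{|H|: |V(H)|=n,\ H\text{ is }\mathcal F\text{-free}\}$, and the Turán density is $\pi(\mathcal F)=\lim_{n\to\infty}\mathrm{ex}(n,\mathcal F)/\binom nr$; $\pi(F)=\pi(\{F\})$. A partial hypergraph is a finite vertex set together with a finite collection $e_1,\dots,e_t$ of subsets of it (partial edges, not necessarily of the same size). If all $|e_j|\le r$, its $r$-uniform extension is the $r$-graph obtained by adding, for each $j\in[t]$, a private set $U_j$ of $r-|e_j|$ new vertices (the $U_j$ pairwise disjoint) and taking as edges the sets $e_j\cup U_j$, $j\in[t]$. Definition of $T^r_{a,b,c,d}$: choose disjoint sets $A,E$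 with $|A|=a$, $|E|=r$, and $B,C\subseteq E$ with $|B|=b$, $|C|=c$, $|B\cap C|=d$. Then $T^r_{a,b,c,d}$ is the $r$-uniform extension of the partial hypergraph on $A\cup E$ with partial edges $E$, $A\cup B$, $A\cup C$. For $L\subseteq[0,b]$, a family $\mathcal B\subseteq\binom{[r]}{b}$ is $L$-intersecting if $|B\cap B'|\in L$ for all distinct $B,B'\in\mathcal B$, and $\Psi(r,b,L)$ is the maximum of $|\mathcal B|$ over $L$-intersecting $\mathcal B\subseteq\binom{[r]}{b}$. *)

theory Defs
  imports Complex_Main "HOL-Library.Disjoint_Sets"
begin

text \<open>A hypergraph is a pair of a vertex set and a set of edges.\<close>

type_synonym 'a hgraph = "'a set \<times> 'a set set"

abbreviation verts :: "'a hgraph \<Rightarrow> 'a set" where "verts \<equiv> fst"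
abbreviation edges :: "'a hgraph \<Rightarrow> 'a set set" where "edges \<equiv> snd"

definition r_graph :: "nat \<Rightarrow> 'a hgraph \<Rightarrow> bool" where
  "r_graph r H \<longleftrightarrow> finite (verts H) \<and> (\<forall>e\<in>edges H. e \<subseteq> verts H \<and> card e = r)"

definition contains_copy :: "'a hgraph \<Rightarrow> 'b hgraph \<Rightarrow> bool" where
  "contains_copy H F \<longleftrightarrow>
     (\<exists>\<phi>. inj_on \<phi> (verts F) \<and> \<phi> ` verts F \<subseteq> verts H \<and> (\<forall>e\<in>edges F. \<phi> ` e \<in> edges H))"

definition free_of :: "'b hgraph set \<Rightarrow> 'a hgraph \<Rightarrow> bool" where
  "free_of \<F> H \<longleftrightarrow> (\<forall>F\<in>\<F>. \<not> contains_copy H F)"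

text \<open>Host graphs may be taken on subsets of the natural numbers, since every finite
  hypergraph is isomorphic to one of these.\<close>

definition ex_number :: "nat \<Rightarrow> nat \<Rightarrow> 'b hgraph set \<Rightarrow> nat" where
  "ex_number r n \<F> =
     Max {card (edges H) | H :: nat hgraph. r_graph r H \<and> card (verts H) = n \<and> free_of \<F> H}"

definition turan_density :: "nat \<Rightarrow> 'b hgraph set \<Rightarrow> real" where
  "turan_density r \<F> = lim (\<lambda>n. real (ex_number r n \<F>) / real (n choose r))"

text \<open>The partial edges form a list, so that equal partial edges are extended separately.\<close>

definition partial_hypergraph :: "'a set \<Rightarrow> 'a set list \<Rightarrow> bool" where
  "partial_hypergraph W es \<longleftrightarrow> finite W \<and> (\<forall>e\<in>set es. e \<subseteq> W)"

text \<open>The extension is determined only up to the choice of the private sets \<open>U j\<close>, hence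
  a predicate; the same holds for \<open>is_T\<close>.\<close>

definition is_uniform_extension :: "nat \<Rightarrow> 'a set \<Rightarrow> 'a set list \<Rightarrow> 'a hgraph \<Rightarrow> bool" where
  "is_uniform_extension r W es F \<longleftrightarrow>
     partial_hypergraph W es \<and> (\<forall>e\<in>set es. card e \<le> r) \<and>
     (\<exists>U :: nat \<Rightarrow> 'a set.
        (\<forall>j<length es. finite (U j) \<and> card (U j) = r - card (es ! j) \<and> U j \<inter> W = {}) \<and>
        disjoint_family_on U {..<length es} \<and>
        verts F = W \<union> (\<Union>j<length es. U j) \<and>
        edges F = {es ! j \<union> U j | j. j < length es})"

definition is_T :: "nat \<Rightarrow> nat \<Rightarrow> nat \<Rightarrow> nat \<Rightarrow> nat \<Rightarrow> 'a hgraph \<Rightarrow> bool" where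
  "is_T r a b c d F \<longleftrightarrow>
     (\<exists>A E B C. finite A \<and> finite E \<and> A \<inter> E = {} \<and> card A = a \<and> card E = r \<and>
        B \<subseteq> E \<and> C \<subseteq> E \<and> card B = b \<and> card C = c \<and> card (B \<inter> C) = d \<and>
        is_uniform_extension r (A \<union> E) [E, A \<union> B, A \<union> C] F)"

definition L_intersecting :: "nat set \<Rightarrow> 'a set set \<Rightarrow> bool" where
  "L_intersecting L \<B> \<longleftrightarrow> (\<forall>B\<in>\<B>. \<forall>B'\<in>\<B>. B \<noteq> B' \<longrightarrow> card (B \<inter> B') \<in> L)"

definition Psi :: "nat \<Rightarrow> nat \<Rightarrow> nat set \<Rightarrow> nat" where
  "Psi r b L = Max {card \<B> | \<B>. \<B> \<subseteq> {B. B \<subseteq> {1..r} \<and> card B = b} \<and> L_intersecting L \<B>}"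

lemma is_T_exists:
  assumes "d \<le> c" "c \<le> b" "b + c - d \<le> r" "a + b \<le> r"
  shows "\<exists>F :: nat hgraph. is_T r a b c d F"
proof -
  obtain k where k: "b = k + d" "k + c \<le> r"
    by (rule that[of "b - d"]) (use assms in linarith)+
  define A where "A = {0..<a}"
  define E where "E = {a..<a+r}"
  define B where "B = {a..<a+b}"
  define C where "C = {a+k..<a+k+c}"
  define es where "es = [E, A \<union> B, A \<union> C]"
  define U where "U j = {a+r+j*r..<a+r+j*r+(r - card (es ! j))}" for j
  define F where "F = (A \<union> E \<union> (\<Union>j<length es. U j), {es ! j \<union> U j | j. j < length es})"
  have BC: "B \<inter> C = {a+k..<a+b}" using assms(1) k(1) by (simp add: B_def C_def)
  have sub: "B \<subseteq> E" "C \<subseteq> E" using assms(4) k(2) by (simp_all add: B_def C_def E_def)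
  have "card (A \<union> B) = a + b" "card (A \<union> C) = a + c"
    by (subst card_Un_disjoint; auto simp: A_def B_def C_def)+
  moreover have "disjoint_family_on U {..<length es}"
  proof (clarsimp simp: disjoint_family_on_def)
    have dis: "U i \<inter> U j = {}" if "i < j" for i j
    proof -
      have "i*r + r \<le> j*r" using that mult_le_mono1[of "Suc i" j r] by simp
      thus ?thesis by (auto simp: U_def)
    qed
    fix i j :: nat assume "i \<noteq> j"
    thus "U i \<inter> U j = {}" using dis[of i j] dis[of j i] by (cases "i < j") auto
  qed
  moreover have "U j \<inter> (A \<union> E) = {}" for j by (auto simp: U_def A_def E_def)
  moreover have "finite (U j)" "card (U j) = r - card (es ! j)" for j by (auto simp: U_def)
  moreover have "card E = r" "finite (A \<union> E)" by (auto simp: A_def E_def)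
  ultimately have "is_uniform_extension r (A \<union> E) es F"
    unfolding is_uniform_extension_def partial_hypergraph_def F_def fst_conv snd_conv
    using assms sub
    by (intro conjI exI[of _ U] allI impI refl; assumption?) (auto simp: es_def)
  moreover have "finite A" "finite E" "A \<inter> E = {}" "card A = a" "card E = r" "card B = b" "card C = c"
    by (auto simp: A_def B_def C_def E_def)
  moreover have "card (B \<inter> C) = d" using BC k(1) by simp
  ultimately show ?thesis unfolding is_T_def es_def using sub by blast
qed

end

theory Submission
  imports Defs "HOL-Analysis.Convex" "HOL-Combinatorics.Permutations" "HOL-Number_Theory.Cong"
begin

text \<open>Let \<open>H\<close> be \<open>T\<close>-free. Up to \<open>O(n ^ (r - 1))\<close> edges, every subset of an edge of \<open>H\<close> can be
  completed to an edge of \<open>H\<close> avoiding any \<open>2 r\<close> prescribed vertices, so private vertices come for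
  free. Hence for an \<open>a\<close>-set \<open>A\<close> and a remaining edge \<open>E\<close> disjoint from \<open>A\<close>, the \<open>b\<close>-sets \<open>B \<subseteq> E\<close>
  for which \<open>A \<union> B\<close> lies in a remaining edge form an \<open>L\<close>-intersecting family: if
  \<open>d \<le> |B \<inter> B'| \<le> b - c + d\<close>, some \<open>C \<subseteq> B'\<close> of size \<open>c\<close> meets \<open>B\<close> in \<open>d\<close> points and \<open>E\<close>, \<open>A \<union> B\<close>,
  \<open>A \<union> C\<close> extend to a copy of \<open>T\<close>. So there are at most \<open>\<Psi>\<close> such \<open>B\<close> for each pair \<open>(A, E)\<close>. On the
  other hand a \<open>b\<close>-set of degree \<open>deg B\<close> is covered in this way with a proportion of at least about
  \<open>deg B / (n - b choose r - b)\<close> of all \<open>A\<close>, and Cauchy--Schwarz bounds the sum of \<open>(deg B)\<^sup>2\<close> from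
  below. For \<open>(a, b, c, d) = (i, r - i, r - i, r - 2 i)\<close> the complements of an \<open>L\<close>-intersecting family
  form an intersecting family of \<open>i\<close>-sets, and the Erdos--Ko--Rado theorem applies.\<close>

section \<open>Copies of T and the existence of the Turan density\<close>

abbreviation ksubsets :: "'a set \<Rightarrow> nat \<Rightarrow> 'a set set" where
  "ksubsets V k \<equiv> {S. S \<subseteq> V \<and> card S = k}"

text \<open>Bijections between corresponding blocks of two disjoint families glue to one bijection
  of the unions. This serves both to embed \<open>T\<close> cell by cell and to build permutations
  that carry one set to another of equal size.\<close>

lemma obtain_bij_family:
  assumes P: "disjoint_family_on P I" and Q: "disjoint_family_on Q I"
    and fin: "\<And>i. i \<in> I \<Longrightarrow> finite (P i)" "\<And>i. i \<in> I \<Longrightarrow> finite (Q i)"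
    and card: "\<And>i. i \<in> I \<Longrightarrow> card (P i) = card (Q i)"
  obtains f where "bij_betw f (\<Union>i\<in>I. P i) (\<Union>i\<in>I. Q i)" "\<And>i. i \<in> I \<Longrightarrow> f ` P i = Q i"
proof -
  have "\<forall>i\<in>I. \<exists>g. bij_betw g (P i) (Q i)"
    using fin card by (metis finite_same_card_bij)
  then obtain g where g: "\<And>i. i \<in> I \<Longrightarrow> bij_betw (g i) (P i) (Q i)" by metis
  \<comment> \<open>By disjointness of \<open>P\<close> a point of the union has exactly one index,
    so the choice is determined there.\<close>
  define f where "f x = g (SOME i. i \<in> I \<and> x \<in> P i) x" for x
  have f_eq: "f x = g i x" if "i \<in> I" "x \<in> P i" for i x
  proof -
    have "(SOME j. j \<in> I \<and> x \<in> P j) = i"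
      using that P by (intro some_equality) (auto simp: disjoint_family_on_def)
    thus ?thesis by (simp add: f_def)
  qed
  have bij: "bij_betw f (P i) (Q i)" if "i \<in> I" for i
    using g[OF that] f_eq[OF that] by (simp cong: bij_betw_cong)
  show ?thesis
    using that[OF bij_betw_UNION_disjoint[OF Q bij]] bij by (simp add: bij_betw_def)
qed

lemma is_T_elim:
  assumes "is_T r a b c d T"
  obtains A E B C U\<^sub>1 U\<^sub>2 where
    "finite A" "finite E" "finite U\<^sub>1" "finite U\<^sub>2" "A \<inter> E = {}" "B \<subseteq> E" "C \<subseteq> E"
    "U\<^sub>1 \<inter> (A \<union> E) = {}" "U\<^sub>2 \<inter> (A \<union> E) = {}" "U\<^sub>1 \<inter> U\<^sub>2 = {}"
    "card A = a" "card E = r" "card B = b" "card C = c" "card (B \<inter> C) = d"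
    "card U\<^sub>1 = r - (a + b)" "card U\<^sub>2 = r - (a + c)"
    "verts T = A \<union> E \<union> U\<^sub>1 \<union> U\<^sub>2" "edges T = {E, A \<union> B \<union> U\<^sub>1, A \<union> C \<union> U\<^sub>2}"
proof -
  obtain A E B C where *: "finite A" "finite E" "A \<inter> E = {}" "card A = a" "card E = r"
      "B \<subseteq> E" "C \<subseteq> E" "card B = b" "card C = c" "card (B \<inter> C) = d"
    and ext: "is_uniform_extension r (A \<union> E) [E, A \<union> B, A \<union> C] T"
    using assms unfolding is_T_def by (elim exE conjE) (rule that)
  have len: "length [E, A \<union> B, A \<union> C] = 3" by simp
  obtain U where U: "\<forall>j<3. finite (U j) \<and>
          card (U j) = r - card ([E, A \<union> B, A \<union> C] ! j) \<and> U j \<inter> (A \<union> E) = {}"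
      "disjoint_family_on U {..<3}"
    and T: "verts T = A \<union> E \<union> (\<Union>j<3. U j)"
      "edges T = {[E, A \<union> B, A \<union> C] ! j \<union> U j | j. j < 3}"
    using ext unfolding is_uniform_extension_def len by (elim exE conjE) (rule that)
  have U1: "finite (U j)" "card (U j) = r - card ([E, A \<union> B, A \<union> C] ! j)" "U j \<inter> (A \<union> E) = {}"
    if "j < 3" for j using U(1) that by auto
  have fin: "finite B" "finite C" using * by (auto intro: finite_subset)
  have AB: "card (A \<union> B) = a + b" "card (A \<union> C) = a + c"
    using * fin by (subst card_Un_disjoint; auto)+
  have three: "{..<3::nat} = {0, 1, 2}" by auto
  \<comment> \<open>\<open>E\<close> already has \<open>r\<close> elements, so its private set has
    size \<open>0\<close>.\<close>
  have U0: "U 0 = {}" using U1[of 0] * by simp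
  have "edges T = (\<lambda>j. [E, A \<union> B, A \<union> C] ! j \<union> U j) ` {..<3}"
    using T(2) by auto
  hence "edges T = {E, A \<union> B \<union> U 1, A \<union> C \<union> U 2}"
    unfolding three using U0 by simp
  note edges = this
  have verts: "verts T = A \<union> E \<union> U 1 \<union> U 2"
    unfolding T three using U0 by auto
  have U12: "U 1 \<inter> U 2 = {}" using U(2) by (auto simp: disjoint_family_on_def)
  have cU: "card (U 1) = r - (a + b)" "card (U 2) = r - (a + c)"
    using U1(2)[of 1] U1(2)[of 2] AB by simp_all
  have U1': "finite (U 1)" "finite (U 2)" "U 1 \<inter> (A \<union> E) = {}" "U 2 \<inter> (A \<union> E) = {}"
    using U1 by simp_all
  show ?thesis
    by (rule that[of A E "U 1" "U 2" B C]) (fact * edges verts U12 cU U1')+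
qed

text \<open>The sets \<open>A\<close>, \<open>B\<close>, \<open>C\<close>, \<open>E\<close>,
  \<open>U\<^sub>1\<close>, \<open>U\<^sub>2\<close> cut the vertices into seven disjoint cells
  whose sizes are functions of \<open>r\<close>, \<open>a\<close>, \<open>b\<close>,
  \<open>c\<close>, \<open>d\<close> alone. Two such configurations therefore match cell by cell,
  and a bijection of the cells carries edges to edges.\<close>

lemma contains_copy_T:
  assumes T: "is_T r a b c d T"
    and fin: "finite A" "finite E" "finite U\<^sub>1" "finite U\<^sub>2"
    and disj: "A \<inter> E = {}" "U\<^sub>1 \<inter> (A \<union> E) = {}" "U\<^sub>2 \<inter> (A \<union> E) = {}" "U\<^sub>1 \<inter> U\<^sub>2 = {}"
    and sub: "B \<subseteq> E" "C \<subseteq> E"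
    and card: "card A = a" "card E = r" "card B = b" "card C = c" "card (B \<inter> C) = d"
      "card U\<^sub>1 = r - (a + b)" "card U\<^sub>2 = r - (a + c)"
    and H: "r_graph r H" "E \<in> edges H" "A \<union> B \<union> U\<^sub>1 \<in> edges H" "A \<union> C \<union> U\<^sub>2 \<in> edges H"
  shows "contains_copy H T"
proof -
  obtain A' E' B' C' U\<^sub>1' U\<^sub>2' where T':
    "finite A'" "finite E'" "finite U\<^sub>1'" "finite U\<^sub>2'" "A' \<inter> E' = {}" "B' \<subseteq> E'" "C' \<subseteq> E'"
    "U\<^sub>1' \<inter> (A' \<union> E') = {}" "U\<^sub>2' \<inter> (A' \<union> E') = {}" "U\<^sub>1' \<inter> U\<^sub>2' = {}"
    "card A' = a" "card E' = r" "card B' = b" "card C' = c" "card (B' \<inter> C') = d"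
    "card U\<^sub>1' = r - (a + b)" "card U\<^sub>2' = r - (a + c)"
    "verts T = A' \<union> E' \<union> U\<^sub>1' \<union> U\<^sub>2'" "edges T = {E', A' \<union> B' \<union> U\<^sub>1', A' \<union> C' \<union> U\<^sub>2'}"
    using is_T_elim[OF T] by metis
  let ?P = "[A', B' \<inter> C', B' - C', C' - B', E' - (B' \<union> C'), U\<^sub>1', U\<^sub>2']"
  let ?Q = "[A, B \<inter> C, B - C, C - B, E - (B \<union> C), U\<^sub>1, U\<^sub>2]"
  have seven: "{..<7::nat} = {0, 1, 2, 3, 4, 5, 6}" by auto
  have fin2: "finite B" "finite C" "finite B'" "finite C'"
    using fin T' sub by (auto intro: finite_subset)
  \<comment> \<open>Stated over a fresh type, because it is applied both to the vertices of
    \<open>T\<close> and to those of \<open>H\<close>.\<close>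
  have cells: "card (B - C) = card B - card (B \<inter> C)" "card (C - B) = card C - card (B \<inter> C)"
      "card (E - (B \<union> C)) = card E - (card B + card C - card (B \<inter> C))"
    if "finite E" "B \<subseteq> E" "C \<subseteq> E" for B C E :: "'z set"
  proof -
    have f: "finite B" "finite C" using that by (auto intro: finite_subset)
    show "card (B - C) = card B - card (B \<inter> C)" using f by (simp add: card_Diff_subset_Int)
    show "card (C - B) = card C - card (B \<inter> C)" using f by (simp add: card_Diff_subset_Int Int_commute)
    have "card (B \<union> C) = card B + card C - card (B \<inter> C)" using card_Un_Int[OF f] by simp
    thus "card (E - (B \<union> C)) = card E - (card B + card C - card (B \<inter> C))"
      using f that by (simp add: card_Diff_subset)
  qed
  have disjP: "disjoint_family_on (\<lambda>i. ?P ! i) {..<7}"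
    unfolding seven disjoint_family_on_def using T'(5-10) by (simp; blast)
  have disjQ: "disjoint_family_on (\<lambda>i. ?Q ! i) {..<7}"
    unfolding seven disjoint_family_on_def using disj sub by (simp; blast)
  have finP: "finite (?P ! i)" if "i \<in> {..<7}" for i
    using that fin2 T'(1-4) unfolding seven by auto
  have finQ: "finite (?Q ! i)" if "i \<in> {..<7}" for i
    using that fin2 fin unfolding seven by auto
  have cardPQ: "card (?P ! i) = card (?Q ! i)" if "i \<in> {..<7}" for i
    using that T'(11-17) card unfolding seven
    by (auto simp: cells[OF fin(2) sub] cells[OF T'(2,6,7)])
  obtain f where bij: "bij_betw f (\<Union>i<7. ?P ! i) (\<Union>i<7. ?Q ! i)"
    and im: "\<And>i. i \<in> {..<7} \<Longrightarrow> f ` (?P ! i) = ?Q ! i"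
    using obtain_bij_family[OF disjP disjQ finP finQ cardPQ] by blast
  have im': "f ` A' = A" "f ` (B' \<inter> C') = B \<inter> C" "f ` (B' - C') = B - C" "f ` (C' - B') = C - B"
      "f ` (E' - (B' \<union> C')) = E - (B \<union> C)" "f ` U\<^sub>1' = U\<^sub>1" "f ` U\<^sub>2' = U\<^sub>2"
    using im[of 0] im[of 1] im[of 2] im[of 3] im[of 4] im[of 5] im[of 6] by simp_all
  have "f ` B' = f ` (B' \<inter> C') \<union> f ` (B' - C')" by blast
  hence fB: "f ` B' = B" unfolding im' by blast
  have "f ` C' = f ` (B' \<inter> C') \<union> f ` (C' - B')" by blast
  hence fC: "f ` C' = C" unfolding im' by blast
  have "f ` E' = f ` B' \<union> f ` C' \<union> f ` (E' - (B' \<union> C'))" using T'(6,7) by blast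
  hence fE: "f ` E' = E" unfolding im' fB fC using sub by blast
  have "(\<Union>i<7. ?P ! i) = verts T"
    unfolding seven T'(18) using T'(6,7) by auto
  hence "inj_on f (verts T)" using bij by (simp add: bij_betw_def)
  moreover have "E \<union> (A \<union> B \<union> U\<^sub>1) \<union> (A \<union> C \<union> U\<^sub>2) \<subseteq> verts H"
    using H unfolding r_graph_def by (meson Un_least)
  hence "f ` verts T \<subseteq> verts H" unfolding T'(18) image_Un im' fE by blast
  moreover have "\<forall>e\<in>edges T. f ` e \<in> edges H"
    unfolding T'(19) using H by (simp add: image_Un im' fB fC fE)
  ultimately show ?thesis unfolding contains_copy_def by blast
qed

section \<open>Extremal numbers and convergence of their densities\<close>

lemma edges_subset_ksubsets: "r_graph r H \<Longrightarrow> edges H \<subseteq> ksubsets (verts H) r"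
  by (auto simp: r_graph_def)

lemma finite_edges: "r_graph r H \<Longrightarrow> finite (edges H)"
  by (rule finite_subset[OF edges_subset_ksubsets]) (auto simp: r_graph_def)

lemma card_edges_le: "r_graph r H \<Longrightarrow> card (edges H) \<le> card (verts H) choose r"
  using card_mono[OF _ edges_subset_ksubsets, of H r] n_subsets[of "verts H" r]
  by (simp add: r_graph_def)

lemma finite_ex_set:
  "finite {card (edges H) | H :: nat hgraph. r_graph r H \<and> card (verts H) = n \<and> free_of \<F> H}"
  by (rule finite_subset[of _ "{..n choose r}"]) (auto dest: card_edges_le)

lemma ex_number_ge:
  "r_graph r H \<Longrightarrow> free_of \<F> H \<Longrightarrow> card (edges H) \<le> ex_number r (card (verts H)) \<F>"
  for H :: "nat hgraph"
  unfolding ex_number_def by (rule Max_ge[OF finite_ex_set]) blast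

text \<open>Since every forbidden graph has an edge, the edgeless graph is free of all of them; so
  the maximum is over a nonempty set and is really attained.\<close>

lemma ex_number_attained:
  assumes "\<And>F. F \<in> \<F> \<Longrightarrow> edges F \<noteq> {}"
  obtains H :: "nat hgraph"
  where "r_graph r H" "card (verts H) = n" "free_of \<F> H" "card (edges H) = ex_number r n \<F>"
proof -
  have "r_graph r ({..<n}, {})" "free_of \<F> ({..<n}, {})"
    using assms by (auto simp: r_graph_def free_of_def contains_copy_def)
  hence "{card (edges H) | H :: nat hgraph. r_graph r H \<and> card (verts H) = n \<and> free_of \<F> H} \<noteq> {}"
    by (metis (mono_tags, lifting) card_lessThan empty_Collect_eq fst_conv)
  from Max_in[OF finite_ex_set this] show ?thesis
    using that unfolding ex_number_def by auto
qed

text \<open>Double counting of pairs of a vertex and an edge avoiding it in an extremal graph on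
  \<open>Suc n\<close> vertices: each edge is avoided by \<open>Suc n - r\<close> vertices, and
  deleting a vertex leaves a free graph on \<open>n\<close> vertices.\<close>

lemma ex_number_averaging:
  assumes F: "\<And>F. F \<in> \<F> \<Longrightarrow> edges F \<noteq> {}"
  shows "(Suc n - r) * ex_number r (Suc n) \<F> \<le> Suc n * ex_number r n \<F>"
proof -
  obtain H :: "nat hgraph" where H: "r_graph r H" "card (verts H) = Suc n" "free_of \<F> H"
    "card (edges H) = ex_number r (Suc n) \<F>"
    using ex_number_attained[OF F] by blast
  have fV: "finite (verts H)" using H by (simp add: r_graph_def)
  have "(Suc n - r) * card (edges H) = (\<Sum>v\<in>verts H. card {e\<in>edges H. v \<notin> e})"
  proof (rule sum_multicount[symmetric, OF fV finite_edges[OF H(1)]], safe)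
    fix e assume "e \<in> edges H"
    hence "e \<subseteq> verts H" "card e = r" using H(1) by (auto simp: r_graph_def)
    moreover have "{v \<in> verts H. v \<notin> e} = verts H - e" by auto
    ultimately show "card {v \<in> verts H. v \<notin> e} = Suc n - r"
      using H(2) fV by (simp add: card_Diff_subset finite_subset)
  qed
  also have "\<dots> \<le> (\<Sum>v\<in>verts H. ex_number r n \<F>)"
  proof (rule sum_mono)
    fix v assume v: "v \<in> verts H"
    let ?H = "(verts H - {v}, {e\<in>edges H. v \<notin> e})"
    have "r_graph r ?H" using H(1) by (auto simp: r_graph_def)
    moreover have "free_of \<F> ?H"
      using H(3) unfolding free_of_def contains_copy_def by fastforce
    moreover have "card (verts ?H) = n" using v H(2) by simp
    ultimately show "card {e\<in>edges H. v \<notin> e} \<le> ex_number r n \<F>"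
      using ex_number_ge[of r ?H \<F>] by simp
  qed
  finally show ?thesis using H by simp
qed

text \<open>\<open>lim\<close> carries information only for a convergent sequence. By averaging, the
  densities decrease from \<open>n = r\<close> on, and they are bounded below by
  \<open>0\<close>.\<close>

lemma turan_density_LIMSEQ:
  assumes F: "\<And>F. F \<in> \<F> \<Longrightarrow> edges F \<noteq> {}"
  shows "(\<lambda>n. real (ex_number r n \<F>) / real (n choose r)) \<longlonglongrightarrow> turan_density r \<F>"
proof -
  define x where "x n = real (ex_number r n \<F>) / real (n choose r)" for n
  have step: "x (Suc n) \<le> x n" if "r \<le> n" for n
  proof -
    have eq: "real (Suc n - r) * real (Suc n choose r) = real (Suc n) * real (n choose r)"
      using binomial_absorb_comp[of "Suc n" r] by (metis diff_Suc_1 of_nat_mult)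
    have le: "real (Suc n - r) * real (ex_number r (Suc n) \<F>) \<le> real (Suc n) * real (ex_number r n \<F>)"
      using ex_number_averaging[OF F, where r = r and n = n] by (metis of_nat_mono of_nat_mult)
    have pos: "real (Suc n - r) > 0" "real (n choose r) > 0" "real (Suc n choose r) > 0"
      using that by auto
    have "x (Suc n) = (real (Suc n - r) * real (ex_number r (Suc n) \<F>)) /
        (real (Suc n - r) * real (Suc n choose r))"
      unfolding x_def using pos by simp
    also have "\<dots> \<le> (real (Suc n) * real (ex_number r n \<F>)) / (real (Suc n) * real (n choose r))"
      unfolding eq by (rule divide_right_mono[OF le]) simp
    also have "\<dots> = x n" unfolding x_def by (simp del: of_nat_Suc)
    finally show ?thesis .
  qed
  \<comment> \<open>The shift by \<open>r\<close> skips the indices where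
    \<open>n choose r = 0\<close> and the quotient takes the default value \<open>0\<close>.\<close>
  have "decseq (\<lambda>n. x (n + r))"
    by (rule decseq_SucI) (use step in simp)
  moreover have "0 \<le> x (n + r)" for n by (simp add: x_def)
  ultimately obtain l where "(\<lambda>n. x (n + r)) \<longlonglongrightarrow> l"
    using decseq_convergent by metis
  hence "x \<longlonglongrightarrow> l" by (rule LIMSEQ_offset)
  hence "x \<longlonglongrightarrow> lim x" by (simp add: limI)
  thus ?thesis unfolding turan_density_def x_def .
qed

section \<open>The Erdos--Ko--Rado theorem\<close>

text \<open>A permutation of \<open>V\<close> taking \<open>S\<close> to \<open>S'\<close> exists,
  because the two sets and their complements have equal sizes. Composing with it is an injection
  between the two sets of permutations.\<close>

lemma card_permutes_image_le:
  assumes V: "finite V" and S: "S \<subseteq> V" "S' \<subseteq> V" "card S = card S'"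
  shows "card {\<sigma>. \<sigma> permutes V \<and> \<sigma> ` K = S} \<le> card {\<sigma>. \<sigma> permutes V \<and> \<sigma> ` K = S'}"
proof -
  let ?P = "\<lambda>x. if x then S else V - S" and ?Q = "\<lambda>x. if x then S' else V - S'"
  have fin: "finite S" "finite S'" using V S by (auto intro: finite_subset)
  have 1: "disjoint_family_on ?P UNIV" "disjoint_family_on ?Q UNIV"
    by (auto simp: disjoint_family_on_def)
  have 2: "finite (?P x)" "finite (?Q x)" "card (?P x) = card (?Q x)" for x
    using V S fin by (auto simp: card_Diff_subset)
  obtain f where f: "bij_betw f (\<Union>x. ?P x) (\<Union>x. ?Q x)" "\<And>x. f ` ?P x = ?Q x"
    using obtain_bij_family[OF 1 2] by (metis UNIV_I)
  have "(\<Union>x. ?P x) = V" "(\<Union>x. ?Q x) = V" using S by (auto split: if_splits)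
  hence bij: "bij_betw f V V" using f(1) by simp
  \<comment> \<open>\<open>permutes\<close> demands the identity outside \<open>V\<close>.\<close>
  define \<tau> where "\<tau> x = (if x \<in> V then f x else x)" for x
  have "bij_betw \<tau> V V" using bij by (simp add: \<tau>_def cong: bij_betw_cong)
  hence \<tau>: "\<tau> permutes V" by (rule bij_imp_permutes) (simp add: \<tau>_def)
  have "\<tau> ` S = f ` S" using S(1) by (intro image_cong) (auto simp: \<tau>_def)
  hence \<tau>S: "\<tau> ` S = S'" using f(2)[of True] by simp
  show ?thesis
  proof (rule card_inj_on_le[of "(\<circ>) \<tau>"])
    show "inj_on ((\<circ>) \<tau>) {\<sigma>. \<sigma> permutes V \<and> \<sigma> ` K = S}"
      by (rule inj_on_subset[OF fun.inj_map[OF permutes_inj[OF \<tau>]]]) simp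
    show "(\<circ>) \<tau> ` {\<sigma>. \<sigma> permutes V \<and> \<sigma> ` K = S} \<subseteq> {\<sigma>. \<sigma> permutes V \<and> \<sigma> ` K = S'}"
      using \<tau> \<tau>S by (auto intro: permutes_compose simp flip: image_comp)
    show "finite {\<sigma>. \<sigma> permutes V \<and> \<sigma> ` K = S'}"
      using finite_permutations[OF V] by (rule finite_subset[rotated]) auto
  qed
qed

text \<open>A random permutation sends \<open>K\<close> to a uniformly random set of its size. By
  symmetry each such set is hit by the same number \<open>N\<close> of permutations, and summing
  over all of them determines \<open>N\<close>.\<close>

lemma card_permutes_image_in:
  assumes V: "finite V" and K: "K \<subseteq> V" and F: "F \<subseteq> ksubsets V (card K)"
  shows "card {\<sigma>. \<sigma> permutes V \<and> \<sigma> ` K \<in> F} * (card V choose card K) = card F * fact (card V)"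
proof -
  define N where "N = card {\<sigma>. \<sigma> permutes V \<and> \<sigma> ` K = K}"
  have N: "card {\<sigma>. \<sigma> permutes V \<and> \<sigma> ` K = S} = N" if "S \<in> ksubsets V (card K)" for S
    unfolding N_def using that K V by (intro antisym card_permutes_image_le) auto
  have count: "card {\<sigma>. \<sigma> permutes V \<and> \<sigma> ` K \<in> G} = card G * N"
    if G: "G \<subseteq> ksubsets V (card K)" for G
  proof -
    have "{\<sigma>. \<sigma> permutes V \<and> \<sigma> ` K \<in> G} = (\<Union>S\<in>G. {\<sigma>. \<sigma> permutes V \<and> \<sigma> ` K = S})" by auto
    also have "card \<dots> = (\<Sum>S\<in>G. card {\<sigma>. \<sigma> permutes V \<and> \<sigma> ` K = S})"
    proof (rule card_UN_disjoint)
      show "finite G" by (rule finite_subset[OF G]) (simp add: V)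
      show "\<forall>S\<in>G. finite {\<sigma>. \<sigma> permutes V \<and> \<sigma> ` K = S}"
        by (intro ballI finite_subset[OF _ finite_permutations[OF V]]) auto
    qed auto
    also have "\<dots> = (\<Sum>S\<in>G. N)" using G N by (intro sum.cong) auto
    finally show ?thesis by simp
  qed
  have "\<sigma> ` K \<in> ksubsets V (card K)" if "\<sigma> permutes V" for \<sigma>
    using that K permutes_image[OF that] permutes_inj_on[OF that, of K] by (auto simp: card_image)
  hence "{\<sigma>. \<sigma> permutes V \<and> \<sigma> ` K \<in> ksubsets V (card K)} = {\<sigma>. \<sigma> permutes V}" by blast
  hence "fact (card V) = (card V choose card K) * N"
    using count[of "ksubsets V (card K)"] card_permutations[OF refl V] n_subsets[OF V, of "card K"]
    by simp
  thus ?thesis using count[OF F] by simp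
qed

lemma mod_less_double:
  fixes s r :: nat
  assumes "s < 2 * r"
  shows "s mod r = (if s < r then s else s - r)"
  using assms by (simp add: le_mod_geq)

text \<open>Rotate one arc to start at \<open>0\<close>. Every arc meeting it starts at some
  \<open>t < i\<close> or some \<open>t > r - i\<close>, and the arcs starting at \<open>t\<close>
  and at \<open>t + (r - i)\<close> are disjoint, so each of the \<open>i\<close> pairs of starts
  contributes at most one arc.\<close>

lemma card_intersecting_arcs:
  fixes r i :: nat
  assumes J: "J \<subseteq> {..<r}" and i: "2 * i \<le> r"
    and meet: "\<And>j j'. j \<in> J \<Longrightarrow> j' \<in> J \<Longrightarrow> \<exists>k<i. \<exists>k'<i. (j + k) mod r = (j' + k') mod r"
  shows "card J \<le> i"
proof (cases "J = {}")
  case False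
  then obtain j\<^sub>0 where j0: "j\<^sub>0 \<in> J" by blast
  \<comment> \<open>The start of arc \<open>j\<close> relative to \<open>j\<^sub>0\<close> modulo
    \<open>r\<close>, with the wrap-around made explicit to avoid truncated subtraction.\<close>
  define t where "t j = (if j\<^sub>0 \<le> j then j - j\<^sub>0 else j + r - j\<^sub>0)" for j
  have less: "j < r" if "j \<in> J" for j using J that by auto
  have t: "t j < r" if "j \<in> J" for j using less[OF that] less[OF j0] by (auto simp: t_def)
  have t_inj: "j = j'" if "j \<in> J" "j' \<in> J" "t j = t j'" for j j'
    using that less[OF that(1)] less[OF that(2)] less[OF j0] by (auto simp: t_def split: if_splits)
  have tmeet: "\<exists>k<i. \<exists>k'<i. (t j + k) mod r = (t j' + k') mod r" if jj: "j \<in> J" "j' \<in> J" for j j'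
  proof -
    obtain k k' where k: "k < i" "k' < i" "[j + k = j' + k'] (mod r)"
      using meet[OF jj] unfolding cong_def by blast
    have *: "[j\<^sub>0 + t l = l] (mod r)" if "l \<in> J" for l
      using less[OF j0] by (simp add: t_def cong_def)
    have "[j\<^sub>0 + (t j + k) = j + k] (mod r)"
      using cong_add[OF *[OF jj(1)] cong_refl[of k]] by (simp add: add.assoc)
    also note k(3)
    also have "[j' + k' = j\<^sub>0 + (t j' + k')] (mod r)"
      using cong_add[OF *[OF jj(2)] cong_refl[of k']] by (simp add: add.assoc cong_sym_eq)
    finally have "[t j + k = t j' + k'] (mod r)" by (simp add: cong_add_lcancel_nat)
    thus ?thesis using k unfolding cong_def by blast
  qed
  have t_cases: "t j < i \<or> r - i < t j" if j: "j \<in> J" for j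
  proof -
    obtain k k' where "k < i" "k' < i" "(t j\<^sub>0 + k) mod r = (t j + k') mod r"
      using tmeet[OF j0 j] by blast
    moreover have "t j\<^sub>0 = 0" by (simp add: t_def)
    ultimately show ?thesis
      using i t[OF j] mod_less_double[of "t j + k'" r] by (auto split: if_splits)
  qed
  \<comment> \<open>On the cycle, the arc from \<open>t j + (r - i)\<close> ends right before the
    arc from \<open>t j\<close> starts; as \<open>2 * i \<le> r\<close>, the two do not meet at the
    other end either.\<close>
  have disj: "t j' \<noteq> t j + (r - i)" if j: "j \<in> J" "j' \<in> J" "t j < i" for j j'
  proof
    assume eq: "t j' = t j + (r - i)"
    obtain k k' where k: "k < i" "k' < i" "(t j + k) mod r = (t j' + k') mod r"
      using tmeet[OF j(1,2)] by blast
    have "t j + k < 2 * r" "t j' + k' < 2 * r" using k i t[OF j(1)] t[OF j(2)] by linarith+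
    thus False
      using k eq i j(3) t[OF j(2)] mod_less_double[of "t j + k" r] mod_less_double[of "t j' + k'" r]
      by (auto split: if_splits)
  qed
  \<comment> \<open>The value of \<open>g\<close> names the pair of starts to which
    \<open>t j\<close> belongs.\<close>
  define g where "g j = (if t j < i then t j else t j - (r - i))" for j
  have "inj_on g J"
  proof (rule inj_onI)
    fix j j' assume jj: "j \<in> J" "j' \<in> J" "g j = g j'"
    have "t j = t j'"
    proof (cases "t j < i"; cases "t j' < i")
      assume *: "t j < i" "\<not> t j' < i"
      hence "t j = t j' - (r - i)" "r - i < t j'"
        using jj(3) t_cases[OF jj(2)] by (simp_all add: g_def)
      hence "t j' = t j + (r - i)" by linarith
      thus ?thesis using disj[OF jj(1,2) *(1)] by blast
    next
      assume *: "\<not> t j < i" "t j' < i"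
      hence "t j' = t j - (r - i)" "r - i < t j"
        using jj(3) t_cases[OF jj(1)] by (simp_all add: g_def)
      hence "t j = t j' + (r - i)" by linarith
      thus ?thesis using disj[OF jj(2,1) *(2)] by blast
    next
      assume "\<not> t j < i" "\<not> t j' < i"
      hence "t j - (r - i) = t j' - (r - i)" "r - i < t j" "r - i < t j'"
        using jj(3) t_cases[OF jj(1)] t_cases[OF jj(2)] by (simp_all add: g_def)
      thus ?thesis by linarith
    qed (use jj(3) in \<open>simp add: g_def\<close>)
    thus "j = j'" using t_inj jj by blast
  qed
  moreover have "g ` J \<subseteq> {..<i}"
  proof safe
    fix j assume "j \<in> J"
    thus "g j < i" using t[of j] t_cases[of j] i unfolding g_def by auto
  qed
  ultimately have "card J \<le> card {..<i}" by (intro card_inj_on_le) auto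
  thus ?thesis by simp
qed simp

text \<open>Katona's cycle method: average over all cyclic arrangements of the ground set, using that
  at most \<open>i\<close> arcs of length \<open>i\<close> of one cycle pairwise intersect.\<close>

theorem Erdos_Ko_Rado:
  assumes V: "finite V" and i: "2 * i \<le> card V"
    and F: "F \<subseteq> ksubsets V i" and meet: "\<And>S S'. S \<in> F \<Longrightarrow> S' \<in> F \<Longrightarrow> S \<inter> S' \<noteq> {}"
  shows "card V * card F \<le> i * (card V choose i)"
proof -
  define r where "r = card V"
  obtain h where h: "bij_betw h {0..<r} V"
    using ex_bij_betw_nat_finite[OF V] unfolding r_def by blast
  define arc where "arc j = (\<lambda>k. (j + k) mod r) ` {..<i}" for j
  have arc_sub: "arc j \<subseteq> {0..<r}" if "j < r" for j using that by (auto simp: arc_def)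
  have card_arc: "card (arc j) = i" if "j < r" for j
  proof -
    have "inj_on (\<lambda>k. (j + k) mod r) {..<i}"
    proof (rule inj_onI)
      fix k k' assume "k \<in> {..<i}" "k' \<in> {..<i}" "(j + k) mod r = (j + k') mod r"
      thus "k = k'" using that i mod_less_double[of "j + k" r] mod_less_double[of "j + k'" r]
        by (auto simp: r_def split: if_splits)
    qed
    thus ?thesis by (simp add: arc_def card_image)
  qed
  have inj_h: "inj_on h {0..<r}" using h by (simp add: bij_betw_def)
  have K: "h ` arc j \<subseteq> V" "card (h ` arc j) = i" if "j < r" for j
    using arc_sub[OF that] card_arc[OF that] h inj_on_subset[OF inj_h arc_sub[OF that]]
    by (auto simp: bij_betw_def card_image)
  let ?P = "{\<sigma>. \<sigma> permutes V}"
  \<comment> \<open>Pairs of a permutation and an arc carried into \<open>F\<close> are counted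
    twice: per arc the number is known by uniformity, per permutation it is at most
    \<open>i\<close>.\<close>
  have "r * card F * fact r = (\<Sum>j<r. card F * fact r)" by simp
  also have "\<dots> = (\<Sum>j<r. card {\<sigma>\<in>?P. \<sigma> ` h ` arc j \<in> F} * (r choose i))"
    using card_permutes_image_in[OF V K(1)] K(2) F by (intro sum.cong) (auto simp: r_def)
  also have "\<dots> = (\<Sum>j<r. card {\<sigma>\<in>?P. \<sigma> ` h ` arc j \<in> F}) * (r choose i)"
    by (simp add: sum_distrib_right)
  also have "(\<Sum>j<r. card {\<sigma>\<in>?P. \<sigma> ` h ` arc j \<in> F}) = (\<Sum>\<sigma>\<in>?P. card {j\<in>{..<r}. \<sigma> ` h ` arc j \<in> F})"
    by (rule sum_multicount_gen) (simp_all add: finite_permutations V)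
  also have "\<dots> \<le> (\<Sum>\<sigma>\<in>?P. i)"
  proof (rule sum_mono)
    fix \<sigma> assume "\<sigma> \<in> ?P"
    hence inj_\<sigma>: "inj \<sigma>" using permutes_inj by blast
    show "card {j\<in>{..<r}. \<sigma> ` h ` arc j \<in> F} \<le> i"
    proof (rule card_intersecting_arcs)
      fix j j' assume j: "j \<in> {j\<in>{..<r}. \<sigma> ` h ` arc j \<in> F}" "j' \<in> {j\<in>{..<r}. \<sigma> ` h ` arc j \<in> F}"
      hence "\<sigma> ` h ` arc j \<inter> \<sigma> ` h ` arc j' \<noteq> {}" using meet by blast
      hence "h ` arc j \<inter> h ` arc j' \<noteq> {}" using inj_\<sigma> by (simp flip: image_Int)
      hence "h ` (arc j \<inter> arc j') \<noteq> {}"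
        using j arc_sub[of j] arc_sub[of j'] by (subst inj_on_image_Int[OF inj_h]) auto
      thus "\<exists>k<i. \<exists>k'<i. (j + k) mod r = (j' + k') mod r" by (auto simp: arc_def)
    qed (use i in \<open>auto simp: r_def\<close>)
  qed
  also have "\<dots> = fact r * i"
    using card_permutations[OF refl V] by (simp add: r_def)
  finally show ?thesis
    unfolding r_def by (simp add: algebra_simps)
qed

section \<open>Properties of \<open>Psi\<close>\<close>

lemma finite_Psi_set:
  "finite {card \<B> | \<B>. \<B> \<subseteq> ksubsets {1..r::nat} b \<and> L_intersecting L \<B>}"
  by (rule finite_subset[of _ "{..card (ksubsets {1..r} b)}"]) (auto intro!: card_mono)

lemma Psi_attained:
  obtains \<B> where "\<B> \<subseteq> ksubsets {1..r} b" "L_intersecting L \<B>" "card \<B> = Psi r b L"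
proof -
  have "{card \<B> | \<B>. \<B> \<subseteq> ksubsets {1..r} b \<and> L_intersecting L \<B>} \<noteq> {}"
    by (auto simp: L_intersecting_def)
  from Max_in[OF finite_Psi_set this] show ?thesis using that unfolding Psi_def by auto
qed

text \<open>Intersection sizes are preserved by a bijection from \<open>E\<close> to
  \<open>{1..r}\<close>, so the ground set in the definition of \<open>Psi\<close> may be any set of
  size \<open>r\<close>.\<close>

lemma card_le_Psi:
  assumes E: "finite E" "card E = r" and F: "F \<subseteq> ksubsets E b" "L_intersecting L F"
  shows "card F \<le> Psi r b L"
proof -
  obtain f where f: "bij_betw f E {1..r}"
    using E by (metis card_atLeastAtMost diff_Suc_1 finite_atLeastAtMost finite_same_card_bij)
  hence inj: "inj_on f E" and im: "f ` E = {1..r}" by (simp_all add: bij_betw_def)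
  have "inj_on ((`) f) F"
    using F(1) inj by (intro inj_on_subset[OF inj_on_image_Pow[OF inj]]) auto
  hence "card ((`) f ` F) = card F" by (rule card_image)
  moreover have "f ` S \<subseteq> {1..r} \<and> card (f ` S) = b" if "S \<in> F" for S
    using that F(1) inj_on_subset[OF inj] unfolding im[symmetric] by (auto simp: card_image)
  hence "(`) f ` F \<subseteq> ksubsets {1..r} b" by blast
  moreover have "L_intersecting L ((`) f ` F)"
    unfolding L_intersecting_def
  proof (clarsimp)
    fix S S' assume S: "S \<in> F" "S' \<in> F" "f ` S \<noteq> f ` S'"
    have sub: "S \<subseteq> E" "S' \<subseteq> E" using S F(1) by auto
    have "f ` S \<inter> f ` S' = f ` (S \<inter> S')" using inj_on_image_Int[OF inj sub] by simp
    moreover have "card (f ` (S \<inter> S')) = card (S \<inter> S')"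
      using inj sub by (intro card_image) (auto intro: inj_on_subset)
    moreover have "card (S \<inter> S') \<in> L" using S F(2) unfolding L_intersecting_def by blast
    ultimately show "card (f ` S \<inter> f ` S') \<in> L" by simp
  qed
  ultimately have "card F \<in> {card \<B> | \<B>. \<B> \<subseteq> ksubsets {1..r} b \<and> L_intersecting L \<B>}"
    by (metis (mono_tags, lifting) mem_Collect_eq)
  thus ?thesis unfolding Psi_def by (rule Max_ge[OF finite_Psi_set])
qed

text \<open>Two sets of size \<open>r - i\<close> have disjoint complements exactly when they cover
  \<open>{1..r}\<close>, that is, when they meet in \<open>r - 2 * i\<close> points. Excluding this
  size makes the complements an intersecting family of \<open>i\<close>-sets.\<close>

lemma Psi_complement_intersecting_le:
  assumes i: "1 \<le> i" "2 * i \<le> r" and L: "r - 2 * i \<notin> L"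
  shows "r * Psi r (r - i) L \<le> i * (r choose (r - i))"
proof -
  obtain \<B> where \<B>: "\<B> \<subseteq> ksubsets {1..r} (r - i)" "L_intersecting L \<B>" "card \<B> = Psi r (r - i) L"
    by (rule Psi_attained)
  let ?F = "(\<lambda>B. {1..r} - B) ` \<B>"
  have fin: "finite B" if "B \<in> \<B>" for B using that \<B>(1) by (auto intro: finite_subset)
  have "card {1..r} * card ?F \<le> i * (card {1..r} choose i)"
  proof (rule Erdos_Ko_Rado)
    show "?F \<subseteq> ksubsets {1..r} i"
      using \<B>(1) fin i by (auto simp: card_Diff_subset)
    fix S S' assume "S \<in> ?F" "S' \<in> ?F"
    then obtain B B' where B: "B \<in> \<B>" "B' \<in> \<B>" "S = {1..r} - B" "S' = {1..r} - B'" by auto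
    show "S \<inter> S' \<noteq> {}"
    proof
      assume "S \<inter> S' = {}"
      hence "B \<union> B' = {1..r}" using B \<B>(1) by auto
      hence eq: "card B + card B' = r + card (B \<inter> B')"
        using card_Un_Int[OF fin[OF B(1)] fin[OF B(2)]] by simp
      have cB: "card B = r - i" "card B' = r - i" using B \<B>(1) by auto
      have "card (B \<inter> B') = r - 2 * i" using eq cB i by simp
      \<comment> \<open>\<open>L_intersecting\<close> concerns distinct members only; equality would
        make a complement of size \<open>i \<ge> 1\<close> disjoint from itself.\<close>
      moreover have "B \<noteq> B'" using eq cB i by auto
      ultimately show False using \<B>(2) B L unfolding L_intersecting_def by metis
    qed
  qed (use i in auto)
  moreover have "card ?F = card \<B>"
    by (rule card_image) (use \<B>(1) in \<open>auto intro!: inj_onI\<close>)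
  moreover have "r choose (r - i) = r choose i" using i by (intro binomial_symmetric[symmetric]) simp
  ultimately show ?thesis using \<B>(3) by simp
qed

section \<open>Extendable sets\<close>

definition extendable :: "'a hgraph \<Rightarrow> nat \<Rightarrow> 'a set \<Rightarrow> bool" where
  "extendable H m S \<longleftrightarrow>
     (\<forall>W\<subseteq>verts H. card W \<le> m \<and> W \<inter> S = {} \<longrightarrow> (\<exists>f\<in>edges H. S \<subseteq> f \<and> f \<inter> W = {}))"

text \<open>Completing edges are sought among all edges of \<open>H\<close>, not in the core, so
  deletion does not affect extendability and a single round suffices.\<close>

definition core :: "'a hgraph \<Rightarrow> nat \<Rightarrow> 'a set set" where
  "core H m = {e\<in>edges H. \<forall>S\<subseteq>e. extendable H m S}"

lemma binomial_le_power: "n choose k \<le> n ^ k"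
  by (cases "k \<le> n") (auto simp: binomial_le_pow binomial_eq_0)

text \<open>A non-extendable set \<open>S\<close> has all its edges meet a fixed set of at most \<open>m\<close> further vertices,
  so it lies in only \<open>O(n ^ (r - card S - 1))\<close> edges.\<close>

lemma card_edges_le_core:
  assumes H: "r_graph r H" "card (verts H) = n"
  shows "card (edges H) \<le> card (core H m) + r * m * n ^ (r - 1)"
proof -
  let ?V = "verts H"
  have V: "finite ?V" using H by (simp add: r_graph_def)
  \<comment> \<open>A blocking set is fixed for every \<open>S\<close> at once, with
    \<open>{}\<close> as default for extendable \<open>S\<close>, so that the size bound holds
    without a case distinction.\<close>
  have "\<forall>S. \<exists>W. W \<subseteq> ?V \<and> card W \<le> m \<and>
      (\<not> extendable H m S \<longrightarrow> W \<inter> S = {} \<and> (\<forall>f\<in>edges H. S \<subseteq> f \<longrightarrow> f \<inter> W \<noteq> {}))"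
  proof
    fix S
    show "\<exists>W. W \<subseteq> ?V \<and> card W \<le> m \<and>
      (\<not> extendable H m S \<longrightarrow> W \<inter> S = {} \<and> (\<forall>f\<in>edges H. S \<subseteq> f \<longrightarrow> f \<inter> W \<noteq> {}))"
    proof (cases "extendable H m S")
      case True
      thus ?thesis by (intro exI[of _ "{}"]) auto
    next
      case False
      then obtain W where "W \<subseteq> ?V" "card W \<le> m" "W \<inter> S = {}"
        "\<not> (\<exists>f\<in>edges H. S \<subseteq> f \<and> f \<inter> W = {})"
        unfolding extendable_def by auto
      thus ?thesis by (intro exI[of _ W]) simp
    qed
  qed
  from choice[OF this] obtain W where *: "\<forall>S. W S \<subseteq> ?V \<and> card (W S) \<le> m \<and>
      (\<not> extendable H m S \<longrightarrow> W S \<inter> S = {} \<and> (\<forall>f\<in>edges H. S \<subseteq> f \<longrightarrow> f \<inter> W S \<noteq> {}))"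
    by (rule exE)
  have W: "W S \<subseteq> ?V" "card (W S) \<le> m" "\<not> extendable H m S \<Longrightarrow> W S \<inter> S = {}"
    "\<not> extendable H m S \<Longrightarrow> f \<in> edges H \<Longrightarrow> S \<subseteq> f \<Longrightarrow> f \<inter> W S \<noteq> {}" for S f
    using spec[OF *, of S] by simp_all
  \<comment> \<open>The candidates for an edge through \<open>S\<close> and the blocking vertex
    \<open>w\<close>: only \<open>r - s - 1\<close> vertices remain free, which saves one factor
    \<open>n\<close>.\<close>
  define cover where "cover s S w = (\<lambda>R. insert w (S \<union> R)) ` ksubsets ?V (r - s - 1)"
    for s :: nat and S w
  have "edges H - core H m \<subseteq> (\<Union>s<r. \<Union>S\<in>ksubsets ?V s. \<Union>w\<in>W S. cover s S w)"
  proof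
    fix e assume "e \<in> edges H - core H m"
    then obtain S where S: "e \<in> edges H" "S \<subseteq> e" "\<not> extendable H m S" by (auto simp: core_def)
    have e: "e \<subseteq> ?V" "card e = r" "finite e"
      using S(1) H V by (auto simp: r_graph_def intro: finite_subset)
    have finS: "finite S" using S(2) e(3) by (rule finite_subset)
    obtain w where w: "w \<in> e" "w \<in> W S" "w \<notin> S" using W(3,4)[OF S(3)] S by blast
    \<comment> \<open>\<open>e\<close> meets the blocking set while \<open>S\<close> avoids it, so
      only sizes below \<open>r\<close> occur.\<close>
    have "S \<subset> e" using S w by blast
    hence "card S < r" using e psubset_card_mono by metis
    moreover have "S \<in> ksubsets ?V (card S)" using S e by auto
    moreover have "e - insert w S \<in> ksubsets ?V (r - card S - 1)"
      using S w e finS by (auto simp: card_Diff_subset)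
    moreover have "e = insert w (S \<union> (e - insert w S))" using S w by blast
    ultimately show "e \<in> (\<Union>s<r. \<Union>S\<in>ksubsets ?V s. \<Union>w\<in>W S. cover s S w)"
      unfolding cover_def using w(2) by blast
  qed
  moreover have finW: "finite (W S)" for S using W(1) V by (rule finite_subset)
  moreover have fin_cover: "finite (cover s S w)" for s S w using V by (simp add: cover_def)
  ultimately have "card (edges H - core H m) \<le> card (\<Union>s<r. \<Union>S\<in>ksubsets ?V s. \<Union>w\<in>W S. cover s S w)"
    using V by (intro card_mono) auto
  also have "\<dots> \<le> (\<Sum>s<r. card (\<Union>S\<in>ksubsets ?V s. \<Union>w\<in>W S. cover s S w))"
    by (rule card_UN_le) simp
  also have "\<dots> \<le> (\<Sum>s<r. m * n ^ (r - 1))"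
  proof (rule sum_mono)
    fix s assume s: "s \<in> {..<r}"
    have one: "card (\<Union>w\<in>W S. cover s S w) \<le> m * n ^ (r - s - 1)" for S
    proof -
      have "card (\<Union>w\<in>W S. cover s S w) \<le> (\<Sum>w\<in>W S. card (cover s S w))"
        by (rule card_UN_le[OF finW])
      also have "\<dots> \<le> (\<Sum>w\<in>W S. n ^ (r - s - 1))"
      proof (rule sum_mono)
        fix w
        have "card (cover s S w) \<le> card (ksubsets ?V (r - s - 1))"
          unfolding cover_def using V by (intro card_image_le) simp
        thus "card (cover s S w) \<le> n ^ (r - s - 1)"
          using n_subsets[OF V] H(2) binomial_le_power[of n "r - s - 1"] by simp
      qed
      also have "\<dots> \<le> m * n ^ (r - s - 1)" using W(2)[of S] by simp
      finally show ?thesis .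
    qed
    have "card (\<Union>S\<in>ksubsets ?V s. \<Union>w\<in>W S. cover s S w) \<le>
        (\<Sum>S\<in>ksubsets ?V s. card (\<Union>w\<in>W S. cover s S w))"
      using V by (intro card_UN_le) simp
    also have "\<dots> \<le> (\<Sum>S\<in>ksubsets ?V s. m * n ^ (r - s - 1))"
      by (intro sum_mono one)
    also have "\<dots> = (n choose s) * (m * n ^ (r - s - 1))"
      using n_subsets[OF V, of s] H(2) by simp
    also have "\<dots> \<le> n ^ s * (m * n ^ (r - s - 1))"
      by (intro mult_right_mono binomial_le_power) simp
    also have "\<dots> = m * n ^ (s + (r - s - 1))" by (simp add: power_add)
    also have "s + (r - s - 1) = r - 1" using s by auto
    finally show "card (\<Union>S\<in>ksubsets ?V s. \<Union>w\<in>W S. cover s S w) \<le> m * n ^ (r - 1)" .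
  qed
  finally have "card (edges H - core H m) \<le> r * m * n ^ (r - 1)" by simp
  moreover have "card (edges H) \<le> card (core H m) + card (edges H - core H m)"
    using finite_edges[OF H(1)] card_Diff_subset[of "core H m" "edges H"]
    by (simp add: core_def)
  ultimately show ?thesis by linarith
qed

text \<open>An intersection size outside the allowed set lies between \<open>d\<close> and
  \<open>b - c + d\<close>, which is just what is needed to find \<open>C\<close> inside
  \<open>B'\<close>. Extendability then supplies the two private sets one after the other.\<close>

lemma core_link_L_intersecting:
  assumes H: "r_graph r H" and T: "is_T r a b c d T" and free: "\<not> contains_copy H T"
    and le: "d \<le> c" "c \<le> b"
    and A: "A \<subseteq> verts H" "card A = a" and E: "E \<in> core H (2 * r)" "A \<inter> E = {}"
  shows "L_intersecting ({0..<d} \<union> {b - c + d + 1..b})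
    {B\<in>ksubsets E b. A \<inter> B = {} \<and> (\<exists>e\<in>core H (2 * r). A \<union> B \<subseteq> e)}"
  unfolding L_intersecting_def
proof (intro ballI impI, rule ccontr)
  fix B B'
  assume "B \<in> {B\<in>ksubsets E b. A \<inter> B = {} \<and> (\<exists>e\<in>core H (2 * r). A \<union> B \<subseteq> e)}"
    and "B' \<in> {B\<in>ksubsets E b. A \<inter> B = {} \<and> (\<exists>e\<in>core H (2 * r). A \<union> B \<subseteq> e)}"
    and notL: "card (B \<inter> B') \<notin> {0..<d} \<union> {b - c + d + 1..b}"
  then obtain e e' where B: "B \<subseteq> E" "card B = b" "e \<in> core H (2 * r)" "A \<union> B \<subseteq> e"
    and B': "B' \<subseteq> E" "card B' = b" "e' \<in> core H (2 * r)" "A \<union> B' \<subseteq> e'" by auto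
  have V: "finite (verts H)" using H by (simp add: r_graph_def)
  have E': "E \<in> edges H" "E \<subseteq> verts H" "card E = r" using E H by (auto simp: core_def r_graph_def)
  have fin: "finite A" "finite E" using A E' V by (auto intro: finite_subset)
  have finB: "finite B" "finite B'" using B B' fin by (auto intro: finite_subset)
  have "card (B \<inter> B') \<le> b" using card_mono[of B "B \<inter> B'"] finB B by simp
  hence m: "d \<le> card (B \<inter> B')" "card (B \<inter> B') \<le> b - c + d" using notL by auto
  \<comment> \<open>\<open>C\<close> takes \<open>d\<close> points inside \<open>B\<close> and
    \<open>c - d\<close> points of \<open>B'\<close> outside \<open>B\<close>; the two bounds on the
    intersection say that enough points of each kind exist.\<close>
  obtain D where D: "D \<subseteq> B \<inter> B'" "card D = d" "finite D"
    using obtain_subset_with_card_n[OF m(1)] by blast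
  have "card (B' - B) = b - card (B \<inter> B')"
    using finB B' card_Diff_subset_Int[of B' B] by (simp add: Int_commute)
  hence "c - d \<le> card (B' - B)" using m le by simp
  then obtain Q where Q: "Q \<subseteq> B' - B" "card Q = c - d" "finite Q"
    using obtain_subset_with_card_n by blast
  define C where "C = D \<union> Q"
  have "D \<inter> Q = {}" using D Q by blast
  hence "card C = c" unfolding C_def using D Q le by (simp add: card_Un_disjoint)
  moreover have "B \<inter> C = D" using D Q by (auto simp: C_def)
  moreover have CB': "C \<subseteq> B'" using D Q by (auto simp: C_def)
  ultimately have C: "C \<subseteq> E" "card C = c" "card (B \<inter> C) = d" "A \<union> C \<subseteq> e'" "finite C"
    using B' D finB by (auto intro: finite_subset)
  have ext: "extendable H (2 * r) (A \<union> B)" "extendable H (2 * r) (A \<union> C)"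
    using B(3,4) B'(3) C(4) by (auto simp: core_def)
  have cards: "card (A \<union> B) = a + b" "card (A \<union> C) = a + c"
    using A B C fin finB E(2) by (subst card_Un_disjoint; auto)+
  \<comment> \<open>Forbidding \<open>E - B\<close> keeps the new vertices of the edge through
    \<open>A \<union> B\<close> away from \<open>E\<close>.\<close>
  have "card (E - B) \<le> 2 * r" using E' card_mono[of E "E - B"] fin by simp
  moreover have "E - B \<subseteq> verts H" "(E - B) \<inter> (A \<union> B) = {}" using E E' by auto
  ultimately obtain f\<^sub>1 where f1: "f\<^sub>1 \<in> edges H" "A \<union> B \<subseteq> f\<^sub>1" "f\<^sub>1 \<inter> (E - B) = {}"
    using ext(1) unfolding extendable_def by blast
  define U\<^sub>1 where "U\<^sub>1 = f\<^sub>1 - (A \<union> B)"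
  have f1': "f\<^sub>1 \<subseteq> verts H" "card f\<^sub>1 = r" "finite f\<^sub>1"
    using f1 H V by (auto simp: r_graph_def intro: finite_subset)
  have U1: "finite U\<^sub>1" "card U\<^sub>1 = r - (a + b)" "U\<^sub>1 \<inter> (A \<union> E) = {}" "A \<union> B \<union> U\<^sub>1 = f\<^sub>1"
    using f1 f1' cards fin finB by (auto simp: U\<^sub>1_def card_Diff_subset)
  \<comment> \<open>The second edge must also avoid the first private set. At most \<open>r\<close>
    vertices from each part are forbidden, whence the parameter \<open>2 * r\<close> of the
    core.\<close>
  have "card ((E - C) \<union> U\<^sub>1) \<le> card E + card U\<^sub>1"
    using card_Un_le[of "E - C" U\<^sub>1] card_mono[of E "E - C"] fin by simp
  hence "card ((E - C) \<union> U\<^sub>1) \<le> 2 * r" using E' U1 by simp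
  moreover have "(E - C) \<union> U\<^sub>1 \<subseteq> verts H" "((E - C) \<union> U\<^sub>1) \<inter> (A \<union> C) = {}"
    using E E' f1' U1 C(1) by (auto simp: U\<^sub>1_def)
  ultimately obtain f\<^sub>2 where f2: "f\<^sub>2 \<in> edges H" "A \<union> C \<subseteq> f\<^sub>2" "f\<^sub>2 \<inter> ((E - C) \<union> U\<^sub>1) = {}"
    using ext(2) unfolding extendable_def by blast
  define U\<^sub>2 where "U\<^sub>2 = f\<^sub>2 - (A \<union> C)"
  have f2': "card f\<^sub>2 = r" "finite f\<^sub>2"
    using f2 H V by (auto simp: r_graph_def intro: finite_subset)
  have U2: "finite U\<^sub>2" "card U\<^sub>2 = r - (a + c)" "U\<^sub>2 \<inter> (A \<union> E) = {}" "U\<^sub>1 \<inter> U\<^sub>2 = {}" "A \<union> C \<union> U\<^sub>2 = f\<^sub>2"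
    using f2 f2' cards fin C by (auto simp: U\<^sub>2_def card_Diff_subset)
  show False
    using free contains_copy_T[OF T fin U1(1) U2(1) E(2) U1(3) U2(3,4) B(1) C(1) A(2) E'(3) B(2) C(2,3)
        U1(2) U2(2) H E'(1)] f1(1) f2(1) U1(4) U2(5) by simp
qed

section \<open>Counting edges\<close>

text \<open>The sum of \<open>deg B * N B\<close> counts triples of an edge \<open>e\<close>, a set
  \<open>B\<close> inside it and an \<open>A\<close> with \<open>cov A B\<close>. The link
  hypothesis bounds it above; below, \<open>N B\<close> is at least proportional to
  \<open>deg B\<close> and Cauchy--Schwarz applies. All is kept in natural numbers, free of
  division.\<close>

lemma edge_count_le:
  fixes \<H> :: "'a set set"
  defines "cov A B \<equiv> A \<inter> B = {} \<and> (\<exists>e\<in>\<H>. A \<union> B \<subseteq> e)"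
  assumes V: "finite V" "card V = n" and H: "\<H> \<subseteq> ksubsets V r" and ab: "a + b \<le> r"
    and link: "\<And>A e. A \<in> ksubsets V a \<Longrightarrow> e \<in> \<H> \<Longrightarrow> A \<inter> e = {} \<Longrightarrow>
        card {B \<in> ksubsets e b. cov A B} \<le> M"
  shows "(r choose b)\<^sup>2 * ((r - b) choose a) * card \<H> \<le>
    (M * (n choose a) + (r choose b) * ((n choose a) - ((n - r) choose a))) *
    (n choose b) * ((n - a - b) choose (r - a - b))"
proof (cases "\<H> = {}")
  case False
  define deg where "deg B = card {e\<in>\<H>. B \<subseteq> e}" for B
  define N where "N B = card {A\<in>ksubsets V a. cov A B}" for B
  let ?h = "card \<H>" and ?D = "(n - a - b) choose (r - a - b)" and ?c = "r choose b"
  let ?R = "M * (n choose a) + ?c * ((n choose a) - ((n - r) choose a))"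
  have finH: "finite \<H>" using H V by (auto intro: finite_subset)
  have h: "?h > 0" using False finH by (simp add: card_gt_0_iff)
  have e: "finite e" "card e = r" "e \<subseteq> V" if "e \<in> \<H>" for e
    using that H V by (auto intro: finite_subset)
  have deg: "deg B * ((r - b) choose a) \<le> N B * ?D" if B: "B \<in> ksubsets V b" for B
  proof -
    have finB: "finite B" using B V by (auto intro: finite_subset)
    \<comment> \<open>Pairs \<open>(A, e)\<close> with \<open>A\<close> disjoint from
      \<open>B\<close> and \<open>A \<union> B \<subseteq> e\<close>: each edge through
      \<open>B\<close> admits \<open>(r - b) choose a\<close> sets \<open>A\<close>, and each
      covered \<open>A\<close> lies together with \<open>B\<close> in at most \<open>?D\<close>
      edges.\<close>
    have "((r - b) choose a) * deg B = (\<Sum>A\<in>ksubsets V a. card {e\<in>{e\<in>\<H>. B \<subseteq> e}. A \<inter> B = {} \<and> A \<subseteq> e})"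
      unfolding deg_def
    proof (rule sum_multicount[symmetric], safe)
      fix e' assume e': "e' \<in> \<H>" "B \<subseteq> e'"
      have "{A \<in> ksubsets V a. A \<inter> B = {} \<and> A \<subseteq> e'} = ksubsets (e' - B) a"
        using e(3)[OF e'(1)] by auto
      thus "card {A \<in> ksubsets V a. A \<inter> B = {} \<and> A \<subseteq> e'} = (r - b) choose a"
        using n_subsets[of "e' - B" a] e[OF e'(1)] e' B finB by (simp add: card_Diff_subset)
    qed (use V finH in auto)
    also have "\<dots> \<le> (\<Sum>A\<in>ksubsets V a. if cov A B then ?D else 0)"
    proof (rule sum_mono)
      fix A assume A: "A \<in> ksubsets V a"
      show "card {e\<in>{e\<in>\<H>. B \<subseteq> e}. A \<inter> B = {} \<and> A \<subseteq> e} \<le> (if cov A B then ?D else 0)"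
      proof (cases "cov A B")
        case True
        have AB: "A \<union> B \<subseteq> V" "finite (A \<union> B)" "card (A \<union> B) = a + b"
          using A B finB V True finite_subset[of A V] by (auto simp: card_Un_disjoint cov_def)
        have "card {e\<in>{e\<in>\<H>. B \<subseteq> e}. A \<inter> B = {} \<and> A \<subseteq> e} \<le> card (ksubsets (V - (A \<union> B)) (r - (a + b)))"
        proof (rule card_inj_on_le[of "\<lambda>e. e - (A \<union> B)"])
          show "inj_on (\<lambda>e. e - (A \<union> B)) {e\<in>{e\<in>\<H>. B \<subseteq> e}. A \<inter> B = {} \<and> A \<subseteq> e}"
            by (rule inj_onI) blast
          show "(\<lambda>e. e - (A \<union> B)) ` {e\<in>{e\<in>\<H>. B \<subseteq> e}. A \<inter> B = {} \<and> A \<subseteq> e} \<subseteq>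
              ksubsets (V - (A \<union> B)) (r - (a + b))"
          proof safe
            fix e' assume "e' \<in> \<H>" "B \<subseteq> e'" "A \<subseteq> e'"
            thus "card (e' - (A \<union> B)) = r - (a + b)"
              using e[of e'] AB by (subst card_Diff_subset) auto
          qed (use e(3) in blast)+
        qed (use V in auto)
        also have "\<dots> = ?D"
          using AB V n_subsets[of "V - (A \<union> B)" "r - (a + b)"]
          by (simp add: card_Diff_subset diff_diff_eq del: Un_subset_iff)
        finally show ?thesis using True by simp
      next
        case False
        hence "{e\<in>{e\<in>\<H>. B \<subseteq> e}. A \<inter> B = {} \<and> A \<subseteq> e} = {}" by (auto simp: cov_def)
        thus ?thesis by (simp only: card.empty)
      qed
    qed
    also have "\<dots> = N B * ?D"
      unfolding N_def using V by (simp add: sum.If_cases Int_def)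
    finally show ?thesis by (simp add: mult.commute)
  qed
  have sum_deg: "(\<Sum>B\<in>ksubsets V b. deg B) = ?c * ?h"
    unfolding deg_def
  proof (rule sum_multicount)
    show "\<forall>e'\<in>\<H>. card {B \<in> ksubsets V b. B \<subseteq> e'} = ?c"
    proof
      fix e' assume e': "e' \<in> \<H>"
      have "{B \<in> ksubsets V b. B \<subseteq> e'} = ksubsets e' b" using e(3)[OF e'] by auto
      thus "card {B \<in> ksubsets V b. B \<subseteq> e'} = ?c" using n_subsets e[OF e'] by auto
    qed
  qed (use V finH in auto)
  have upper: "(\<Sum>B\<in>ksubsets V b. deg B * N B) \<le> ?h * ?R"
  proof -
    have "(\<Sum>B\<in>ksubsets V b. deg B * N B) =
        (\<Sum>B\<in>ksubsets V b. card {p \<in> \<H> \<times> ksubsets V a. B \<subseteq> fst p \<and> cov (snd p) B})"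
    proof (rule sum.cong[OF refl])
      fix B
      have "{p \<in> \<H> \<times> ksubsets V a. B \<subseteq> fst p \<and> cov (snd p) B} =
          {e\<in>\<H>. B \<subseteq> e} \<times> {A\<in>ksubsets V a. cov A B}" by auto
      thus "deg B * N B = card {p \<in> \<H> \<times> ksubsets V a. B \<subseteq> fst p \<and> cov (snd p) B}"
        unfolding deg_def N_def by (simp add: card_cartesian_product)
    qed
    also have "\<dots> = (\<Sum>p\<in>\<H> \<times> ksubsets V a. card {B\<in>ksubsets V b. B \<subseteq> fst p \<and> cov (snd p) B})"
      using V finH by (intro sum_multicount_gen) auto
    also have "\<dots> = (\<Sum>e\<in>\<H>. \<Sum>A\<in>ksubsets V a. card {B\<in>ksubsets V b. B \<subseteq> e \<and> cov A B})"
      by (subst sum.cartesian_product) (simp add: case_prod_beta)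
    also have "\<dots> \<le> (\<Sum>e\<in>\<H>. ?R)"
    proof (rule sum_mono)
      fix e' assume e': "e' \<in> \<H>"
      have disj: "{A\<in>ksubsets V a. A \<inter> e' = {}} = ksubsets (V - e') a" by auto
      have card_disj: "card {A\<in>ksubsets V a. A \<inter> e' = {}} = (n - r) choose a"
        unfolding disj using n_subsets[of "V - e'" a] V e[OF e'] by (simp add: card_Diff_subset)
      \<comment> \<open>The link hypothesis covers only those \<open>A\<close> that are disjoint
        from \<open>e'\<close>; the others get the trivial bound \<open>?c\<close>, and they are a
        vanishing proportion as \<open>n\<close> grows.\<close>
      have "(\<Sum>A\<in>ksubsets V a. card {B\<in>ksubsets V b. B \<subseteq> e' \<and> cov A B}) \<le>
          (\<Sum>A\<in>ksubsets V a. M + (if A \<inter> e' = {} then 0 else ?c))"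
      proof (rule sum_mono)
        fix A assume A: "A \<in> ksubsets V a"
        have eq: "{B\<in>ksubsets V b. B \<subseteq> e' \<and> cov A B} = {B\<in>ksubsets e' b. cov A B}"
          using e(3)[OF e'] by auto
        have "card {B\<in>ksubsets e' b. cov A B} \<le> card (ksubsets e' b)"
          using e(1)[OF e'] by (intro card_mono) auto
        also have "\<dots> = ?c" using n_subsets e[OF e'] by auto
        finally show "card {B\<in>ksubsets V b. B \<subseteq> e' \<and> cov A B} \<le> M + (if A \<inter> e' = {} then 0 else ?c)"
          unfolding eq using link[OF A e'] by simp
      qed
      also have "\<dots> = M * (n choose a) + ?c * card (ksubsets V a - {A. A \<inter> e' = {}})"
        using V n_subsets[OF V(1), of a] by (simp add: sum.distrib sum.If_cases Diff_eq mult.commute)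
      also have "ksubsets V a - {A. A \<inter> e' = {}} = ksubsets V a - {A\<in>ksubsets V a. A \<inter> e' = {}}"
        by auto
      also have "card \<dots> = (n choose a) - ((n - r) choose a)"
        using V n_subsets[OF V(1), of a] card_disj by (subst card_Diff_subset) auto
      finally show "(\<Sum>A\<in>ksubsets V a. card {B\<in>ksubsets V b. B \<subseteq> e' \<and> cov A B}) \<le> ?R" .
    qed
    finally show ?thesis by simp
  qed
  \<comment> \<open>Cauchy--Schwarz, taken over the reals and brought back to natural
    numbers.\<close>
  have "real ((\<Sum>B\<in>ksubsets V b. deg B)\<^sup>2) \<le> real ((\<Sum>B\<in>ksubsets V b. (deg B)\<^sup>2) * card (ksubsets V b))"
    using sum_squared_le_sum_of_squares[of "\<lambda>B. real (deg B)" "ksubsets V b"] by simp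
  hence "(?c * ?h)\<^sup>2 \<le> (\<Sum>B\<in>ksubsets V b. (deg B)\<^sup>2) * (n choose b)"
    using sum_deg n_subsets[OF V(1), of b] V(2) by (simp only: of_nat_le_iff)
  hence "(?c * ?h)\<^sup>2 * ((r - b) choose a) \<le> (\<Sum>B\<in>ksubsets V b. (deg B)\<^sup>2) * (n choose b) * ((r - b) choose a)"
    by (rule mult_right_mono) simp
  also have "\<dots> = (\<Sum>B\<in>ksubsets V b. deg B * (deg B * ((r - b) choose a))) * (n choose b)"
    by (simp add: sum_distrib_right sum_distrib_left power2_eq_square mult_ac)
  also have "\<dots> \<le> (\<Sum>B\<in>ksubsets V b. deg B * (N B * ?D)) * (n choose b)"
    by (intro mult_right_mono sum_mono mult_left_mono deg) auto
  also have "\<dots> = (\<Sum>B\<in>ksubsets V b. deg B * N B) * ?D * (n choose b)"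
    by (simp add: sum_distrib_right sum_distrib_left mult_ac)
  also have "\<dots> \<le> ?h * ?R * ?D * (n choose b)"
    by (intro mult_right_mono upper) auto
  \<comment> \<open>Both sides carry a factor \<open>?h\<close>, which is cancelled; hence the
    separate treatment of the empty family.\<close>
  finally have "?h * (?c\<^sup>2 * ((r - b) choose a) * ?h) \<le> ?h * (?R * (n choose b) * ?D)"
    by (simp add: power2_eq_square mult_ac)
  thus ?thesis using h by simp
qed simp

section \<open>Asymptotics\<close>

text \<open>The binomial is a product of \<open>j\<close> factors over \<open>fact j\<close>, and
  each factor divided by \<open>n\<close> tends to \<open>1\<close> whatever the fixed shift
  \<open>k\<close>.\<close>

lemma binomial_div_power_LIMSEQ:
  "(\<lambda>n. real ((n - k) choose j) / real n ^ j) \<longlonglongrightarrow> 1 / fact j"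
proof -
  have "(\<lambda>n. (real (n - k) - real i) / real n) \<longlonglongrightarrow> 1" for i
  proof -
    have "(\<lambda>n. 1 - (real k + real i) * (1 / real n)) \<longlonglongrightarrow> 1 - (real k + real i) * 0"
      by (intro tendsto_intros lim_1_over_n)
    moreover have "\<forall>\<^sub>F n in sequentially. 1 - (real k + real i) * (1 / real n) = (real (n - k) - real i) / real n"
      using eventually_ge_at_top[of "Suc k"]
      by eventually_elim (simp add: field_simps of_nat_diff)
    ultimately show ?thesis by (simp add: filterlim_cong)
  qed
  hence "(\<lambda>n. (\<Prod>i=0..<j. (real (n - k) - real i) / real n) / fact j) \<longlonglongrightarrow> (\<Prod>i=0..<j. 1) / fact j"
    by (intro tendsto_intros) auto
  moreover have "(\<Prod>i=0..<j. (real (n - k) - real i) / real n) / fact j =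
      real ((n - k) choose j) / real n ^ j" for n
    by (simp add: binomial_gbinomial gbinomial_prod_rev prod_dividef)
  ultimately show ?thesis by simp
qed

lemma binomial_ratio_LIMSEQ:
  "(\<lambda>n. real ((n - k) choose j) / real ((n - l) choose j)) \<longlonglongrightarrow> 1"
proof -
  have lim: "(\<lambda>n. (real ((n - k) choose j) / real n ^ j) / (real ((n - l) choose j) / real n ^ j)) \<longlonglongrightarrow>
      (1 / fact j) / (1 / fact j)"
    by (intro tendsto_divide binomial_div_power_LIMSEQ) simp
  have eq: "\<forall>\<^sub>F n in sequentially.
      (real ((n - k) choose j) / real n ^ j) / (real ((n - l) choose j) / real n ^ j) =
      real ((n - k) choose j) / real ((n - l) choose j)"
    using eventually_gt_at_top[of 0] by eventually_elim simp
  show ?thesis using Lim_transform_eventually[OF lim eq] by simp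
qed

text \<open>This makes the edges lost in passing to the core negligible in density.\<close>

lemma power_div_binomial_LIMSEQ:
  assumes "r \<ge> 1"
  shows "(\<lambda>n. real n ^ (r - 1) / real (n choose r)) \<longlonglongrightarrow> 0"
proof -
  have "(\<lambda>n. (1 / real n) / (real ((n - 0) choose r) / real n ^ r)) \<longlonglongrightarrow> 0 / (1 / fact r)"
    by (intro tendsto_divide binomial_div_power_LIMSEQ lim_1_over_n) simp
  moreover have "\<forall>\<^sub>F n in sequentially. (1 / real n) / (real ((n - 0) choose r) / real n ^ r) =
      real n ^ (r - 1) / real (n choose r)"
    using eventually_gt_at_top[of 0]
  proof eventually_elim
    case (elim n)
    have "real n ^ r = real n * real n ^ (r - 1)" using assms by (metis Suc_diff_1 less_eq_Suc_le One_nat_def power_Suc)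
    thus ?case using elim by simp
  qed
  ultimately show ?thesis by (simp add: filterlim_cong)
qed

section \<open>From the edge count to the density bound\<close>

lemma ex_number_T_le:
  fixes T :: "'v hgraph"
  assumes T: "is_T r a b c d T" and le: "d \<le> c" "c \<le> b" "a + b \<le> r" "r \<le> n"
  defines "M \<equiv> Psi r b ({0..<d} \<union> {b - c + d + 1..b})"
  shows "real (ex_number r n {T}) / real (n choose r) \<le>
    (real M * real (n choose a) + real (r choose b) * (real (n choose a) - real ((n - r) choose a))) /
      (real (r choose b) * real ((n - b) choose a)) +
    real (2 * r * r) * (real n ^ (r - 1) / real (n choose r))"
proof -
  have "edges F \<noteq> {}" if "F \<in> {T}" for F using that is_T_elim[OF T] by (metis insert_not_empty singletonD)
  then obtain H :: "nat hgraph" where H: "r_graph r H" "card (verts H) = n" "free_of {T} H"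
    "card (edges H) = ex_number r n {T}"
    by (rule ex_number_attained)
  have free: "\<not> contains_copy H T" using H(3) by (simp add: free_of_def)
  have V: "finite (verts H)" using H(1) by (simp add: r_graph_def)
  let ?C = "core H (2 * r)" and ?c = "r choose b" and ?q = "(r - b) choose a"
  let ?h = "card ?C" and ?D = "(n - a - b) choose (r - a - b)"
  let ?R = "M * (n choose a) + ?c * ((n choose a) - ((n - r) choose a))"
  have sub: "?C \<subseteq> ksubsets (verts H) r" using H(1) by (auto simp: core_def r_graph_def)
  have "?c\<^sup>2 * ?q * ?h \<le> ?R * (n choose b) * ?D"
  proof (rule edge_count_le[OF V H(2) sub le(3)])
    fix A E assume A: "A \<in> ksubsets (verts H) a" and E: "E \<in> ?C" "A \<inter> E = {}"
    have "card E = r" "finite E" using sub E(1) V by (auto intro: finite_subset)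
    thus "card {B \<in> ksubsets E b. A \<inter> B = {} \<and> (\<exists>e\<in>?C. A \<union> B \<subseteq> e)} \<le> M"
      unfolding M_def using core_link_L_intersecting[OF H(1) T free le(1,2) _ _ E] A
      by (intro card_le_Psi[of E]) auto
  qed
  \<comment> \<open>The extra factor completes the binomials on the right to a count of nested
    choices: picking \<open>B\<close>, then \<open>A\<close>, then the rest of an
    \<open>r\<close>-set equals picking the \<open>r\<close>-set first, then \<open>B\<close> and
    \<open>A\<close> in it. So \<open>n choose r\<close> appears and \<open>?c * ?q\<close>
    cancels.\<close>
  hence "?c\<^sup>2 * ?q * ?h * ((n - b) choose a) \<le> ?R * ((n choose b) * (((n - b) choose a) * ?D))"
    using mult_right_mono[of _ _ "(n - b) choose a"] by (simp add: mult_ac)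
  also have "((n - b) choose a) * ?D = ((n - b) choose (r - b)) * ?q"
    using choose_mult[of a "r - b" "n - b"] le by (simp add: add.commute)
  also have "(n choose b) * (((n - b) choose (r - b)) * ?q) = (n choose r) * ?c * ?q"
    using choose_mult[of b r n] le by simp
  finally have "(?c * ?q) * (?c * ?h * ((n - b) choose a)) \<le> (?c * ?q) * (?R * (n choose r))"
    by (simp add: power2_eq_square mult_ac)
  moreover have "?c * ?q > 0" using le by simp
  ultimately have "?c * ?h * ((n - b) choose a) \<le> ?R * (n choose r)"
    using mult_le_cancel1 by blast
  hence "real (?c * ?h * ((n - b) choose a)) \<le> real (?R * (n choose r))"
    by (rule of_nat_mono)
  moreover have "(n - r) choose a \<le> n choose a" by (rule binomial_right_mono) simp
  ultimately have key: "real ?c * real ?h * real ((n - b) choose a) \<le>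
      (real M * real (n choose a) + real ?c * (real (n choose a) - real ((n - r) choose a))) * real (n choose r)"
    by (simp add: of_nat_diff)
  have pos: "real ?c * real ((n - b) choose a) > 0" "real (n choose r) > 0" using le by auto
  have core: "real ?h / real (n choose r) \<le>
     (real M * real (n choose a) + real ?c * (real (n choose a) - real ((n - r) choose a))) /
      (real ?c * real ((n - b) choose a))"
    using key pos by (simp add: frac_le_eq divide_le_eq le_divide_eq mult_ac)
  \<comment> \<open>The edges outside the core are added back; they give the second summand of the
    bound.\<close>
  have "card (edges H) \<le> ?h + r * (2 * r) * n ^ (r - 1)"
    by (rule card_edges_le_core[OF H(1,2)])
  hence "real (ex_number r n {T}) \<le> real ?h + real (2 * r * r) * real n ^ (r - 1)"
    unfolding H(4) by (metis (no_types, lifting) mult.assoc mult.commute of_nat_add of_nat_mono of_nat_mult of_nat_power)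
  hence "real (ex_number r n {T}) / real (n choose r) \<le>
      (real ?h + real (2 * r * r) * real n ^ (r - 1)) / real (n choose r)"
    by (rule divide_right_mono) simp
  also have "\<dots> = real ?h / real (n choose r) + real (2 * r * r) * (real n ^ (r - 1) / real (n choose r))"
    by (simp add: add_divide_distrib)
  finally show ?thesis using core by linarith
qed

lemma turan_density_T_le:
  fixes T :: "'v hgraph"
  assumes T: "is_T r a b c d T" and le: "1 \<le> r" "d \<le> c" "c \<le> b" "a + b \<le> r"
  shows "turan_density r {T} \<le> real (Psi r b ({0..<d} \<union> {b - c + d + 1..b})) / real (r choose b)"
proof -
  define M where "M = real (Psi r b ({0..<d} \<union> {b - c + d + 1..b}))"
  define c\<^sub>0 where "c\<^sub>0 = real (r choose b)"
  \<comment> \<open>Everything is normalised by \<open>(n - b) choose a\<close>. All ratios tend to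
    \<open>1\<close>, so the contribution \<open>ratio 0 n - ratio r n\<close> of the sets
    \<open>A\<close> meeting the edge vanishes in the limit.\<close>
  define ratio where "ratio k n = real ((n - k) choose a) / real ((n - b) choose a)" for k n
  have c0: "c\<^sub>0 > 0" using le by (simp add: c\<^sub>0_def)
  have ratio: "ratio k \<longlonglongrightarrow> 1" for k
    unfolding ratio_def by (rule binomial_ratio_LIMSEQ)
  have "(\<lambda>n. (M * ratio 0 n + c\<^sub>0 * (ratio 0 n - ratio r n)) / c\<^sub>0 +
      real (2 * r * r) * (real n ^ (r - 1) / real (n choose r))) \<longlonglongrightarrow>
      (M * 1 + c\<^sub>0 * (1 - 1)) / c\<^sub>0 + real (2 * r * r) * 0"
    using c0 by (intro tendsto_intros ratio power_div_binomial_LIMSEQ[OF le(1)]) auto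
  hence bound: "(\<lambda>n. (M * ratio 0 n + c\<^sub>0 * (ratio 0 n - ratio r n)) / c\<^sub>0 +
      real (2 * r * r) * (real n ^ (r - 1) / real (n choose r))) \<longlonglongrightarrow> M / c\<^sub>0"
    by simp
  have "edges F \<noteq> {}" if "F \<in> {T}" for F using that is_T_elim[OF T] by (metis insert_not_empty singletonD)
  hence lim: "(\<lambda>n. real (ex_number r n {T}) / real (n choose r)) \<longlonglongrightarrow> turan_density r {T}"
    by (rule turan_density_LIMSEQ)
  have "turan_density r {T} \<le> M / c\<^sub>0"
  proof (rule LIMSEQ_le[OF lim bound], intro exI allI impI)
    fix n assume n: "r \<le> n"
    have "(M * real (n choose a) + c\<^sub>0 * (real (n choose a) - real ((n - r) choose a))) /
      (c\<^sub>0 * real ((n - b) choose a)) = (M * ratio 0 n + c\<^sub>0 * (ratio 0 n - ratio r n)) / c\<^sub>0"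
      by (simp add: ratio_def add_divide_distrib diff_divide_distrib mult.commute right_diff_distrib)
    thus "real (ex_number r n {T}) / real (n choose r) \<le>
        (M * ratio 0 n + c\<^sub>0 * (ratio 0 n - ratio r n)) / c\<^sub>0 +
        real (2 * r * r) * (real n ^ (r - 1) / real (n choose r))"
      using ex_number_T_le[OF T le(2-4) n] unfolding M_def c\<^sub>0_def by simp
  qed
  thus ?thesis by (simp add: M_def c\<^sub>0_def)
qed

theorem theorem1p1:
  "(\<forall>(r::nat) (a::nat) (b::nat) (c::nat) (d::nat) (T :: 'v hgraph).
      r \<ge> 2 \<and> a \<ge> 1 \<and> d \<le> c \<and> c \<le> b \<and> b \<le> r \<and> b + c - d \<le> r \<and> a + b \<le> r \<and>
      is_T r a b c d T \<longrightarrow>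
      turan_density r {T} \<le> real (Psi r b ({0..<d} \<union> {b - c + d + 1..b})) / real (r choose b)) \<and>
   (\<forall>(i::nat) (r::nat) (T :: 'v hgraph).
      i \<ge> 1 \<and> r \<ge> 2 * i \<and> is_T r i (r - i) (r - i) (r - 2 * i) T \<longrightarrow>
      turan_density r {T} \<le> real i / real r)"
proof (intro conjI allI impI; elim conjE)
  fix r a b c d :: nat and T :: "'v hgraph"
  assume "2 \<le> r" "d \<le> c" "c \<le> b" "a + b \<le> r" "is_T r a b c d T"
  thus "turan_density r {T} \<le> real (Psi r b ({0..<d} \<union> {b - c + d + 1..b})) / real (r choose b)"
    by (intro turan_density_T_le) auto
next
  fix i r :: nat and T :: "'v hgraph"
  assume i: "1 \<le> i" "2 * i \<le> r" and T: "is_T r i (r - i) (r - i) (r - 2 * i) T"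
  \<comment> \<open>For these parameters \<open>?L\<close> omits from \<open>{0..r - i}\<close> only
    the size \<open>r - 2 * i\<close>; it is left unsimplified to match the general bound.\<close>
  let ?L = "{0..<r - 2 * i} \<union> {r - i - (r - i) + (r - 2 * i) + 1..r - i}"
  have "turan_density r {T} \<le> real (Psi r (r - i) ?L) / real (r choose (r - i))"
    using i by (intro turan_density_T_le[OF T]) auto
  also have "\<dots> \<le> real i / real r"
  proof -
    have "r * Psi r (r - i) ?L \<le> i * (r choose (r - i))"
      using i by (intro Psi_complement_intersecting_le) auto
    hence "real r * real (Psi r (r - i) ?L) \<le> real i * real (r choose (r - i))"
      by (metis of_nat_mono of_nat_mult)
    thus ?thesis using i by (simp add: divide_le_eq le_divide_eq mult_ac)
  qed
  finally show "turan_density r {T} \<le> real i / real r" .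
qed

end
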